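(* Let $w\in\beta\mathbb Z\setminus\{0\}$. The quotient $(\beta\mathbb Z,\oplus)/{\equiv^{\mathrm s}_w}$ may be identified with (is isomorphic to) a subgroup of the ultraproduct $\prod_w\mathbb Z/n\mathbb Z$, which is isomorphic to a quotient (as abstract groups) of $\hat{\mathbb Z}$. If $w$ is self-divisible, then it is isomorphic to $\prod_{p\in\mathbb P}G_p$, where $G_p=\mathbb Z_p$ if $\varphi_w(p)=\omega$, and $G_p=\mathbb Z/p^{\varphi_w(p)}\mathbb Z$ otherwise.
   Context: $\omega=\{0,1,2,\dots\}$, $\mathbb P$ is the set of primes, $\mathbb Z_p$ the additive group of $p$-adic integers, $\hat{\mathbb Z}=\varprojlim\mathbb Z/n\mathbb Z$ the profinite completion of $(\mathbb Z,+)$. $\beta\mathbb Z$ is the space of ultrafilters on $\mathbb Z$; integers are identified with principal ultrafilters. For $u,v\in\beta\mathbb Z$: $A\in u\oplus v$ iff $\{x:\{y:x+y\in A\}\in v\}\in u$; $-u=\{-A:A\in u\}$; $u\ominus v=u\oplus(-v)$. - For $w\neq0$: $u\equiv^{\mathrm s}_w v$ iff $\{n\in\mathbb Z:n\mathbb Z\in u\ominus v\}\in w$. It is known that $\equiv^{\mathrm s}_w$ is an equivalence relation compatible with $\oplus$. - $D(w)=\{n\in\mathbb Z:n\mathbb Z\in w\}$; $w\in\beta\mathbb Z\setminus\{0\}$ is self-divisible iff $D(w)\in w$. - $\varphi_w:\mathbb P\to\omega+1$ sends $p$ to $\max\{k\in\omega:p^k\mathbb Z\in w\}$ if this exists, and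 to $\omega$ otherwise. - $\prod_w\mathbb Z/n\mathbb Z$ is the ultraproduct along $w$ of the groups $\mathbb Z/n\mathbb Z$, indexed by nonzero integers $n$. *)

theory Defs
  imports
    "HOL-Algebra.Product_Groups"
    "HOL-Algebra.Weak_Morphisms"
    "HOL-Library.Extended_Nat"
    "HOL-Computational_Algebra.Primes"
begin

section \<open>Ultrafilters on the integers\<close>

text \<open>Ultrafilters are filters in the sense of \<^typ>\<open>'a filter\<close>; a set \<open>A\<close> belongs to \<open>u\<close> iff
  \<open>x \<in> A\<close> holds eventually along \<open>u\<close>.  The integer \<open>k\<close> is identified with \<open>principal {k}\<close>.\<close>

abbreviation mem_filter :: "'a set \<Rightarrow> 'a filter \<Rightarrow> bool"  (infix "\<in>\<^sub>F" 50)
  where "A \<in>\<^sub>F u \<equiv> eventually (\<lambda>x. x \<in> A) u"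

definition ultrafilter :: "'a filter \<Rightarrow> bool"
  where "ultrafilter u \<longleftrightarrow> u \<noteq> bot \<and> (\<forall>A. A \<in>\<^sub>F u \<or> - A \<in>\<^sub>F u)"

definition uf_plus :: "int filter \<Rightarrow> int filter \<Rightarrow> int filter"
  where "uf_plus u v = Abs_filter (\<lambda>P. {x. {y. x + y \<in> Collect P} \<in>\<^sub>F v} \<in>\<^sub>F u)"

definition uf_uminus :: "int filter \<Rightarrow> int filter"
  where "uf_uminus u = filtermap uminus u"

definition uf_minus :: "int filter \<Rightarrow> int filter \<Rightarrow> int filter"
  where "uf_minus u v = uf_plus u (uf_uminus v)"

lemma mem_uf_plus: "A \<in>\<^sub>F uf_plus u v \<longleftrightarrow> {x. {y. x + y \<in> A} \<in>\<^sub>F v} \<in>\<^sub>F u"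
  unfolding uf_plus_def
  by (subst eventually_Abs_filter, rule is_filter.intro)
     (auto simp: eventually_conj_iff elim!: eventually_mono)

lemma mem_uf_uminus: "A \<in>\<^sub>F uf_uminus u \<longleftrightarrow> uminus ` A \<in>\<^sub>F u"
proof -
  have "- x \<in> A \<longleftrightarrow> x \<in> uminus ` A" for x :: int
    by (metis imageE imageI minus_minus)
  then show ?thesis by (simp add: uf_uminus_def eventually_filtermap)
qed

lemma ultrafilter_not_mem:
  assumes u: "ultrafilter u"
  shows "- A \<in>\<^sub>F u \<longleftrightarrow> \<not> A \<in>\<^sub>F u"
proof
  assume A: "- A \<in>\<^sub>F u"
  show "\<not> A \<in>\<^sub>F u"
  proof
    assume "A \<in>\<^sub>F u"
    with A have "eventually (\<lambda>x. False) u" by eventually_elim simp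
    with u show False by (simp add: ultrafilter_def)
  qed
next
  assume "\<not> A \<in>\<^sub>F u"
  with u show "- A \<in>\<^sub>F u" by (auto simp: ultrafilter_def)
qed

lemma ultrafilter_principal: "ultrafilter (principal {x})"
  by (auto simp: ultrafilter_def eventually_principal principal_eq_bot_iff)

lemma ultrafilter_uf_plus:
  assumes "ultrafilter u" "ultrafilter v"
  shows "ultrafilter (uf_plus u v)"
  unfolding ultrafilter_def
proof (intro conjI allI)
  show "uf_plus u v \<noteq> bot"
  proof
    assume "uf_plus u v = bot"
    then have "{} \<in>\<^sub>F uf_plus u v" by simp
    then show False unfolding mem_uf_plus using assms by (simp add: ultrafilter_def)
  qed
  fix A
  have "{y. x + y \<in> - A} \<in>\<^sub>F v \<longleftrightarrow> \<not> {y. x + y \<in> A} \<in>\<^sub>F v" for x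
    using ultrafilter_not_mem[OF assms(2), of "{y. x + y \<in> A}"] by (simp add: Collect_neg_eq)
  then have "{x. {y. x + y \<in> - A} \<in>\<^sub>F v} = - {x. {y. x + y \<in> A} \<in>\<^sub>F v}"
    by blast
  then show "A \<in>\<^sub>F uf_plus u v \<or> - A \<in>\<^sub>F uf_plus u v"
    unfolding mem_uf_plus using ultrafilter_not_mem[OF assms(1)] by metis
qed

lemma ultrafilter_uf_uminus:
  assumes "ultrafilter u"
  shows "ultrafilter (uf_uminus u)"
proof -
  have "- A \<in>\<^sub>F uf_uminus u \<longleftrightarrow> - (uminus ` A) \<in>\<^sub>F u" for A :: "int set"
  proof -
    have "uminus ` (- A) = - (uminus ` A)" by (rule bij_image_Compl_eq) (rule bij_uminus)
    then show ?thesis by (simp only: mem_uf_uminus)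
  qed
  then show ?thesis
    using assms unfolding ultrafilter_def mem_uf_uminus
    by (simp add: uf_uminus_def filtermap_bot_iff)
qed

definition betaZ :: "int filter monoid"
  where "betaZ = \<lparr>carrier = {u. ultrafilter u}, monoid.mult = uf_plus, one = principal {0}\<rparr>"


section \<open>Strong congruence and self-divisibility\<close>

abbreviation multiples :: "int \<Rightarrow> int set"
  where "multiples n \<equiv> range ((*) n)"

definition strong_cong :: "int filter \<Rightarrow> (int filter \<times> int filter) set"
  where "strong_cong w =
    {(u, v). ultrafilter u \<and> ultrafilter v \<and> {n. multiples n \<in>\<^sub>F uf_minus u v} \<in>\<^sub>F w}"

definition divisors_uf :: "int filter \<Rightarrow> int set"
  where "divisors_uf w = {n. multiples n \<in>\<^sub>F w}"

definition self_divisible :: "int filter \<Rightarrow> bool"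
  where "self_divisible w \<longleftrightarrow> divisors_uf w \<in>\<^sub>F w"

text \<open>The value \<open>\<infinity>\<close> plays the role of \<open>\<omega>\<close> in \<open>\<omega> + 1\<close>.\<close>

definition phi :: "int filter \<Rightarrow> nat \<Rightarrow> enat"
  where "phi w p =
    (let K = {k. multiples (int p ^ k) \<in>\<^sub>F w}
     in if \<exists>k\<in>K. \<forall>j\<in>K. j \<le> k then enat (GREATEST k. k \<in> K) else \<infinity>)"


section \<open>Quotients and ultraproducts\<close>

definition quotient_monoid :: "'a monoid \<Rightarrow> ('a \<times> 'a) set \<Rightarrow> 'a set monoid"
  where "quotient_monoid G r =
    \<lparr>carrier = carrier G // r,
     monoid.mult = (\<lambda>A B. \<Union>a\<in>A. \<Union>b\<in>B. r `` {a \<otimes>\<^bsub>G\<^esub> b}),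
     one = r `` {\<one>\<^bsub>G\<^esub>}\<rparr>"

definition ultraproduct_group ::
    "'i set \<Rightarrow> 'i filter \<Rightarrow> ('i \<Rightarrow> 'a monoid) \<Rightarrow> ('i \<Rightarrow> 'a) set monoid"
  where "ultraproduct_group I w G =
    quotient_monoid (product_group I G)
      {(f, g). f \<in> carrier (product_group I G) \<and> g \<in> carrier (product_group I G) \<and>
               {i \<in> I. f i = g i} \<in>\<^sub>F w}"

definition ultraproduct_Zmod :: "int filter \<Rightarrow> (int \<Rightarrow> int) set monoid"
  where "ultraproduct_Zmod w =
    ultraproduct_group (UNIV - {0}) w (\<lambda>n. integer_mod_group (nat \<bar>n\<bar>))"

lemma group_quotient_monoid:
  assumes G: "group G" and r: "equiv (carrier G) r"
    and cong: "\<And>a a' b b'. (a, a') \<in> r \<Longrightarrow> (b, b') \<in> r \<Longrightarrow> (a \<otimes>\<^bsub>G\<^esub> b, a' \<otimes>\<^bsub>G\<^esub> b') \<in> r"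
  shows "group (quotient_monoid G r)"
proof -
  interpret group G by fact
  have c2: "congruent2 r r (\<lambda>a b. r `` {a \<otimes>\<^bsub>G\<^esub> b})"
    unfolding congruent2_def using cong equiv_class_eq[OF r] by blast
  have m: "r `` {a} \<otimes>\<^bsub>quotient_monoid G r\<^esub> r `` {b} = r `` {a \<otimes>\<^bsub>G\<^esub> b}"
    if "a \<in> carrier G" "b \<in> carrier G" for a b
    using UN_equiv_class2[OF r r c2 that] by (simp add: quotient_monoid_def)
  have c: "carrier (quotient_monoid G r) = (\<lambda>a. r `` {a}) ` carrier G"
    by (auto simp: quotient_monoid_def quotient_def)
  have o: "\<one>\<^bsub>quotient_monoid G r\<^esub> = r `` {\<one>\<^bsub>G\<^esub>}"
    by (simp add: quotient_monoid_def)
  show ?thesis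
  proof (rule groupI)
    fix x assume "x \<in> carrier (quotient_monoid G r)"
    then obtain a where a: "a \<in> carrier G" "x = r `` {a}" by (auto simp: c)
    then have "r `` {inv\<^bsub>G\<^esub> a} \<otimes>\<^bsub>quotient_monoid G r\<^esub> x = \<one>\<^bsub>quotient_monoid G r\<^esub>"
      by (simp add: m o)
    then show "\<exists>y\<in>carrier (quotient_monoid G r). y \<otimes>\<^bsub>quotient_monoid G r\<^esub> x = \<one>\<^bsub>quotient_monoid G r\<^esub>"
      using a by (auto simp: c)
  qed (auto simp: c o m m_assoc)
qed

lemma equiv_ultraproduct:
  assumes "I \<in>\<^sub>F w"
  shows "equiv C {(f, g). f \<in> C \<and> g \<in> C \<and> {i \<in> I. f i = g i} \<in>\<^sub>F w}"
proof (intro equivI)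
  let ?r = "{(f, g). f \<in> C \<and> g \<in> C \<and> {i \<in> I. f i = g i} \<in>\<^sub>F w}"
  show "?r \<subseteq> C \<times> C" by auto
  show "refl_on C ?r" using assms by (auto simp: refl_on_def)
  show "sym ?r" by (auto simp: sym_def eq_commute)
  show "trans ?r"
  proof (rule transI)
    fix f g h assume a: "(f, g) \<in> ?r" "(g, h) \<in> ?r"
    then have "{i \<in> I. f i = g i} \<in>\<^sub>F w" "{i \<in> I. g i = h i} \<in>\<^sub>F w" by auto
    then have "{i \<in> I. f i = h i} \<in>\<^sub>F w" by eventually_elim simp
    then show "(f, h) \<in> ?r" using a by simp
  qed
qed

lemma group_ultraproduct_group:
  assumes "I \<in>\<^sub>F w" "\<And>i. i \<in> I \<Longrightarrow> group (G i)"
  shows "group (ultraproduct_group I w G)"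
  unfolding ultraproduct_group_def
proof (rule group_quotient_monoid)
  show P: "group (product_group I G)" using assms(2) by (rule product_group)
  interpret group "product_group I G" by (rule P)
  fix a a' b b'
  let ?C = "carrier (product_group I G)"
  let ?r = "{(f, g). f \<in> ?C \<and> g \<in> ?C \<and> {i \<in> I. f i = g i} \<in>\<^sub>F w}"
  assume r: "(a, a') \<in> ?r" "(b, b') \<in> ?r"
  then have "eventually (\<lambda>i. i \<in> I \<and> a i = a' i) w" "eventually (\<lambda>i. i \<in> I \<and> b i = b' i) w"
    by auto
  then have "eventually (\<lambda>i. i \<in> {i \<in> I. (a \<otimes>\<^bsub>product_group I G\<^esub> b) i = (a' \<otimes>\<^bsub>product_group I G\<^esub> b') i}) w"
    by eventually_elim auto
  then show "(a \<otimes>\<^bsub>product_group I G\<^esub> b, a' \<otimes>\<^bsub>product_group I G\<^esub> b') \<in> ?r"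
    using r m_closed[of a b] m_closed[of a' b'] by blast
qed (rule equiv_ultraproduct[OF assms(1)])

lemma group_ultraproduct_Zmod:
  assumes "ultrafilter w" "w \<noteq> principal {0}"
  shows "group (ultraproduct_Zmod w)"
  unfolding ultraproduct_Zmod_def
proof (rule group_ultraproduct_group)
  show "UNIV - {0} \<in>\<^sub>F w"
  proof (rule ccontr)
    assume "\<not> UNIV - {0} \<in>\<^sub>F w"
    then have z: "eventually (\<lambda>x. x = 0) w"
      using ultrafilter_not_mem[OF assms(1), of "{0}"] by (simp add: Compl_eq_Diff_UNIV)
    have "eventually P w \<longleftrightarrow> P 0" for P
    proof
      assume "eventually P w"
      with z have "eventually (\<lambda>x. P 0) w" by eventually_elim simp
      then show "P 0" using assms(1) by (simp add: ultrafilter_def)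
    next
      assume "P 0"
      then show "eventually P w" by (intro eventually_mono[OF z]) simp
    qed
    then show False using assms(2) by (simp add: filter_eq_iff eventually_principal)
  qed
qed simp


section \<open>Profinite groups\<close>

text \<open>The inverse limit of the groups \<open>\<int>/n\<int>\<close> for \<open>n \<in> S\<close>, with \<open>S\<close> ordered by divisibility and
  the reduction maps as transition maps.\<close>

definition invlim_Zmod :: "nat set \<Rightarrow> (nat \<Rightarrow> int) monoid"
  where "invlim_Zmod S =
    (product_group S integer_mod_group)
      \<lparr>carrier := {f \<in> carrier (product_group S integer_mod_group).
                    \<forall>m\<in>S. \<forall>n\<in>S. m dvd n \<longrightarrow> f n mod int m = f m}\<rparr>"

lemma group_invlim_Zmod: "group (invlim_Zmod S)"
proof -
  let ?P = "product_group S integer_mod_group"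
  have P: "group ?P" by (rule product_group) simp
  show ?thesis
    unfolding invlim_Zmod_def
  proof (rule group.subgroup_imp_group[OF P], rule group.subgroupI[OF P])
    show "{f \<in> carrier ?P. \<forall>m\<in>S. \<forall>n\<in>S. m dvd n \<longrightarrow> f n mod int m = f m} \<noteq> {}"
      using group.is_monoid[OF P, THEN monoid.one_closed]
      by (auto intro!: exI[of _ "\<one>\<^bsub>?P\<^esub>"] simp: PiE_iff)
  next
    fix a assume a: "a \<in> {f \<in> carrier ?P. \<forall>m\<in>S. \<forall>n\<in>S. m dvd n \<longrightarrow> f n mod int m = f m}"
    then have i: "(inv\<^bsub>?P\<^esub> a) n = (- a n) mod int n" if "n \<in> S" for n
      using that by (subst inv_product_group) (auto simp: PiE_iff)
    have "(inv\<^bsub>?P\<^esub> a) n mod int m = (inv\<^bsub>?P\<^esub> a) m" if "m \<in> S" "n \<in> S" "m dvd n" for m n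
    proof -
      have "a n mod int m = a m" using a that by auto
      then have "(- a n) mod int m = (- a m) mod int m" by (metis mod_minus_eq)
      then show ?thesis using that by (simp add: i mod_mod_cancel)
    qed
    then show "inv\<^bsub>?P\<^esub> a \<in> {f \<in> carrier ?P. \<forall>m\<in>S. \<forall>n\<in>S. m dvd n \<longrightarrow> f n mod int m = f m}"
      using a group.inv_closed[OF P, of a] by blast
  next
    fix a b
    assume a: "a \<in> {f \<in> carrier ?P. \<forall>m\<in>S. \<forall>n\<in>S. m dvd n \<longrightarrow> f n mod int m = f m}"
      and b: "b \<in> {f \<in> carrier ?P. \<forall>m\<in>S. \<forall>n\<in>S. m dvd n \<longrightarrow> f n mod int m = f m}"
    have "(a \<otimes>\<^bsub>?P\<^esub> b) n mod int m = (a \<otimes>\<^bsub>?P\<^esub> b) m" if "m \<in> S" "n \<in> S" "m dvd n" for m n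
    proof -
      have "a n mod int m = a m" "b n mod int m = b m" using a b that by auto
      then show ?thesis using that by (simp add: mod_mod_cancel) (metis mod_add_eq)
    qed
    then show "a \<otimes>\<^bsub>?P\<^esub> b \<in> {f \<in> carrier ?P. \<forall>m\<in>S. \<forall>n\<in>S. m dvd n \<longrightarrow> f n mod int m = f m}"
      using a b monoid.m_closed[OF group.is_monoid[OF P], of a b] by blast
  qed auto
qed

definition Zhat :: "(nat \<Rightarrow> int) monoid"
  where "Zhat = invlim_Zmod {n. n > 0}"

definition Zp :: "nat \<Rightarrow> (nat \<Rightarrow> int) monoid"
  where "Zp p = invlim_Zmod (range (\<lambda>k. p ^ k))"

text \<open>All factors of a product must have the same element type, so \<open>\<int>/p\<^sup>k\<int>\<close> and \<open>\<int>\<^sub>p\<close> are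
  embedded into a common sum type.\<close>

definition local_factor :: "int filter \<Rightarrow> nat \<Rightarrow> (int + (nat \<Rightarrow> int)) monoid"
  where "local_factor w p =
    (case phi w p of
       enat k \<Rightarrow> image_group Inl (integer_mod_group (p ^ k))
     | \<infinity> \<Rightarrow> image_group Inr (Zp p))"

end

theory Submission
  imports Defs "HOL-Number_Theory.Cong"
begin

text \<open>
  Taking residues modulo every \<open>n > 0\<close> is a surjective homomorphism from \<open>\<beta>\<int>\<close> to the profinite
  integers, and \<open>u \<equiv> v\<close> along \<open>w\<close> says exactly that the residues of \<open>u\<close> and \<open>v\<close> modulo \<open>n\<close> agree
  for \<open>w\<close>-almost all \<open>n\<close>.  Hence the quotient is the image of the profinite integers in the
  ultraproduct.  If \<open>w\<close> is self-divisible, almost every \<open>n\<close> is such that each prime power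
  dividing \<open>n\<close> is one of the \<open>p\<^sup>k\<close> with \<open>k \<le> \<phi>(p)\<close>, and conversely each such \<open>p\<^sup>k\<close> divides almost
  every \<open>n\<close>; so agreement along \<open>w\<close> amounts to agreement modulo these \<open>p\<^sup>k\<close>, i.e. to equality of
  the images in the product of the local factors, onto which the profinite integers map by the
  Chinese remainder theorem.
\<close>

section \<open>Quotient monoids\<close>

text \<open>First isomorphism theorem in the generality needed for \<open>betaZ\<close>, which is
  not a group, so that there is no normal subgroup to factor by. The classes of \<open>r\<close> are
  the fibres of \<open>h\<close>. The product in the quotient is a union over all representatives,
  and it collapses to one class because \<open>h\<close> is multiplicative.\<close>

lemma hom_imp_quotient_monoid_iso:
  assumes h: "h \<in> hom G K" and onto: "h ` carrier G = carrier K"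
    and closed: "\<And>a b. a \<in> carrier G \<Longrightarrow> b \<in> carrier G \<Longrightarrow> a \<otimes>\<^bsub>G\<^esub> b \<in> carrier G"
    and r: "r = {(a, b). a \<in> carrier G \<and> b \<in> carrier G \<and> h a = h b}"
  shows "quotient_monoid G r \<cong> K"
proof -
  have cls: "r `` {a} = {b \<in> carrier G. h b = h a}" if "a \<in> carrier G" for a
    using that by (auto simp: r)
  have carr: "carrier (quotient_monoid G r) = (\<lambda>a. r `` {a}) ` carrier G"
    by (auto simp: quotient_monoid_def quotient_def)
  have img: "h ` (r `` {a}) = {h a}" if "a \<in> carrier G" for a
    using that by (auto simp: cls)
  have elem: "the_elem (h ` (r `` {a})) = h a" if "a \<in> carrier G" for a
    by (simp add: img that)
  have mult: "r `` {a} \<otimes>\<^bsub>quotient_monoid G r\<^esub> r `` {b} = r `` {a \<otimes>\<^bsub>G\<^esub> b}"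
    if a: "a \<in> carrier G" and b: "b \<in> carrier G" for a b
  proof -
    have "r `` {a' \<otimes>\<^bsub>G\<^esub> b'} = r `` {a \<otimes>\<^bsub>G\<^esub> b}" if "a' \<in> r `` {a}" "b' \<in> r `` {b}" for a' b'
      using that a b by (simp add: cls closed hom_mult[OF h])
    moreover have "a \<in> r `` {a}" "b \<in> r `` {b}"
      using a b by (auto simp: cls)
    ultimately show ?thesis
      unfolding quotient_monoid_def monoid.simps by blast
  qed
  have "(\<lambda>X. the_elem (h ` X)) \<in> iso (quotient_monoid G r) K"
  proof (rule isoI)
    show "(\<lambda>X. the_elem (h ` X)) \<in> hom (quotient_monoid G r) K"
    proof (rule homI)
      fix X assume "X \<in> carrier (quotient_monoid G r)"
      then show "the_elem (h ` X) \<in> carrier K"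
        using onto by (auto simp: carr elem)
    next
      fix X Y assume "X \<in> carrier (quotient_monoid G r)" "Y \<in> carrier (quotient_monoid G r)"
      then obtain a b where "a \<in> carrier G" "X = r `` {a}" "b \<in> carrier G" "Y = r `` {b}"
        by (auto simp: carr)
      then show "the_elem (h ` (X \<otimes>\<^bsub>quotient_monoid G r\<^esub> Y)) = the_elem (h ` X) \<otimes>\<^bsub>K\<^esub> the_elem (h ` Y)"
        by (simp add: mult elem closed hom_mult[OF h])
    qed
    show "bij_betw (\<lambda>X. the_elem (h ` X)) (carrier (quotient_monoid G r)) (carrier K)"
    proof (rule bij_betw_imageI)
      show "inj_on (\<lambda>X. the_elem (h ` X)) (carrier (quotient_monoid G r))"
      proof (rule inj_onI)
        fix X Y
        assume "X \<in> carrier (quotient_monoid G r)" "Y \<in> carrier (quotient_monoid G r)"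
          and eq: "the_elem (h ` X) = the_elem (h ` Y)"
        then obtain a b where ab: "a \<in> carrier G" "X = r `` {a}" "b \<in> carrier G" "Y = r `` {b}"
          by (auto simp: carr)
        with eq have "h a = h b" by (simp add: elem)
        with ab show "X = Y" by (simp add: cls)
      qed
      show "(\<lambda>X. the_elem (h ` X)) ` carrier (quotient_monoid G r) = carrier K"
        unfolding carr onto[symmetric] image_image by (intro image_cong refl elem)
    qed
  qed
  then show ?thesis by (auto simp: is_iso_def)
qed

lemma quotient_monoid_class_hom:
  assumes r: "equiv (carrier G) r"
    and cong: "\<And>a a' b b'. (a, a') \<in> r \<Longrightarrow> (b, b') \<in> r \<Longrightarrow> (a \<otimes>\<^bsub>G\<^esub> b, a' \<otimes>\<^bsub>G\<^esub> b') \<in> r"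
  shows "(\<lambda>a. r `` {a}) \<in> hom G (quotient_monoid G r)"
proof (rule homI)
  fix a assume "a \<in> carrier G"
  then show "r `` {a} \<in> carrier (quotient_monoid G r)"
    by (auto simp: quotient_monoid_def quotient_def)
next
  fix a b assume "a \<in> carrier G" "b \<in> carrier G"
  moreover have "congruent2 r r (\<lambda>a b. r `` {a \<otimes>\<^bsub>G\<^esub> b})"
    unfolding congruent2_def using cong equiv_class_eq[OF r] by blast
  ultimately show "r `` {a \<otimes>\<^bsub>G\<^esub> b} = r `` {a} \<otimes>\<^bsub>quotient_monoid G r\<^esub> r `` {b}"
    using UN_equiv_class2[OF r r, of "\<lambda>a b. r `` {a \<otimes>\<^bsub>G\<^esub> b}" a b]
    by (simp add: quotient_monoid_def)
qed


section \<open>Ultrafilters and residues\<close>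

text \<open>The ultrafilter lemma by Zorn: a finite subfamily of a union of a chain lies in one
  member, so the finite intersection property passes to such unions. A maximal family
  \<open>M\<close> decides every set, and the infimum of its principal filters is the
  ultrafilter.\<close>

lemma ultrafilter_finite_intersections:
  assumes fip: "\<And>\<F>. finite \<F> \<Longrightarrow> \<F> \<subseteq> \<B> \<Longrightarrow> \<Inter>\<F> \<noteq> {}"
  obtains u where "ultrafilter u" "\<And>B. B \<in> \<B> \<Longrightarrow> B \<in>\<^sub>F u"
proof -
  define FIP where "FIP \<C> \<longleftrightarrow> (\<forall>\<F>. finite \<F> \<longrightarrow> \<F> \<subseteq> \<C> \<longrightarrow> \<Inter>\<F> \<noteq> {})" for \<C> :: "'a set set"
  let ?\<A> = "{\<C>. \<B> \<subseteq> \<C> \<and> FIP \<C>}"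
  have "\<exists>M\<in>?\<A>. \<forall>X\<in>?\<A>. M \<subseteq> X \<longrightarrow> X = M"
  proof (rule subset_Zorn_nonempty)
    show "?\<A> \<noteq> {}" using fip by (auto simp: FIP_def)
    fix \<K> assume ne: "\<K> \<noteq> {}" and ch: "subset.chain ?\<A> \<K>"
    have sub: "\<K> \<subseteq> ?\<A>" using ch by (simp add: subset_chain_def)
    have "FIP (\<Union>\<K>)"
      unfolding FIP_def
    proof (intro allI impI)
      fix \<F> assume "finite \<F>" "\<F> \<subseteq> \<Union>\<K>"
      then obtain \<C> where "\<C> \<in> \<K>" "\<F> \<subseteq> \<C>"
        using finite_subset_Union_chain[OF _ _ ne ch] by blast
      then show "\<Inter>\<F> \<noteq> {}" using sub \<open>finite \<F>\<close> by (auto simp: FIP_def)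
    qed
    then show "\<Union>\<K> \<in> ?\<A>" using ne sub by blast
  qed
  then obtain M where "M \<in> ?\<A>" and M_max: "\<forall>X\<in>?\<A>. M \<subseteq> X \<longrightarrow> X = M" ..
  then have M: "\<B> \<subseteq> M" "FIP M" by simp_all
  have max: "X = M" if "M \<subseteq> X" "FIP X" for X
    using M_max M(1) that by simp
  define u where "u = (INF B\<in>M. principal B)"
  have mem: "B \<in>\<^sub>F u" if "B \<in> M" for B
    unfolding u_def by (rule eventually_INF1[OF that]) (simp add: eventually_principal)
  have M_or: "A \<in> M \<or> - A \<in> M" for A
  proof -
    have fin: "\<exists>\<F>\<subseteq>M. finite \<F> \<and> \<Inter>\<F> \<inter> A = {}" if "A \<notin> M" for A
    proof -
      have "\<not> FIP (insert A M)" using max[of "insert A M"] that by blast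
      then obtain \<F> where "finite \<F>" "\<F> \<subseteq> insert A M" "\<Inter>\<F> = {}" by (auto simp: FIP_def)
      then show ?thesis by (intro exI[of _ "\<F> - {A}"]) auto
    qed
    \<comment> \<open>If neither \<open>A\<close> nor \<open>- A\<close> were in \<open>M\<close>,
      one finite subfamily would have intersection disjoint from \<open>A\<close> and another
      disjoint from \<open>- A\<close>; their union would then have empty intersection.\<close>
    show ?thesis
    proof (rule ccontr)
      assume "\<not> ?thesis"
      then obtain \<F> \<G> where "\<F> \<subseteq> M" "finite \<F>" "\<Inter>\<F> \<inter> A = {}" "\<G> \<subseteq> M" "finite \<G>" "\<Inter>\<G> \<inter> - A = {}"
        using fin[of A] fin[of "- A"] by auto
      moreover from this have "\<Inter>(\<F> \<union> \<G>) \<noteq> {}" using M(2) by (simp add: FIP_def)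
      ultimately show False by (auto simp: Inter_Un_distrib)
    qed
  qed
  have "u \<noteq> bot"
  proof
    assume "u = bot"
    then have "eventually (\<lambda>x. False) u" by simp
    \<comment> \<open>An infimum of principal filters contains only what is already contained in a
      finite sub-infimum, and that one is principal at the intersection.\<close>
    then have "\<exists>\<F>\<subseteq>M. finite \<F> \<and> eventually (\<lambda>x. False) (INF B\<in>\<F>. principal B)"
      unfolding u_def eventually_INF[of _ principal M] .
    then obtain \<F> where \<F>: "\<F> \<subseteq> M" "finite \<F>" "eventually (\<lambda>x. False) (INF B\<in>\<F>. principal B)"
      by (elim exE conjE)
    have "eventually (\<lambda>x. False) (principal (\<Inter>\<F>))"
      using \<F>(3) INF_principal_finite[OF \<F>(2), of id] by simp
    then have "\<Inter>\<F> = {}" by (auto simp: eventually_principal)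
    with \<F> M(2) show False by (simp add: FIP_def)
  qed
  then have "ultrafilter u" using M_or mem unfolding ultrafilter_def by metis
  then show thesis
  proof (rule that)
    show "B \<in>\<^sub>F u" if "B \<in> \<B>" for B using mem[of B] M(1) that by (simp only: subset_iff)
  qed
qed

text \<open>Serves to evaluate memberships one layer at a time in nested conditions such as those
  defining \<open>uf_plus\<close>.\<close>

lemma ultrafilter_eventually_iff_const:
  assumes "ultrafilter u" "eventually (\<lambda>x. P x \<longleftrightarrow> b) u"
  shows "eventually P u \<longleftrightarrow> b"
  using eventually_subst[OF assms(2)] assms(1) by (simp add: eventually_const ultrafilter_def)

lemma nonzero_mem_ultrafilter:
  assumes "ultrafilter u" "u \<noteq> principal {0}"
  shows "UNIV - {0} \<in>\<^sub>F u"
proof (rule ccontr)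
  assume "\<not> UNIV - {0} \<in>\<^sub>F u"
  then have "{0} \<in>\<^sub>F u"
    using ultrafilter_not_mem[OF assms(1), of "{0}"] by (simp add: Compl_eq_Diff_UNIV)
  then have "eventually P u \<longleftrightarrow> P 0" for P
    by (intro ultrafilter_eventually_iff_const[OF assms(1)]) (auto elim: eventually_mono)
  then have "u = principal {0}" by (simp add: filter_eq_iff eventually_principal)
  with assms(2) show False by simp
qed

text \<open>The finitely many residue classes modulo \<open>n\<close> cover the integers, so they
  cannot all be outside \<open>u\<close>; two different classes are disjoint, so they cannot both
  belong to \<open>u\<close>.\<close>

lemma ultrafilter_ex1_residue:
  assumes u: "ultrafilter u" and n: "n > 0"
  shows "\<exists>!r. eventually (\<lambda>x. x mod int n = r) u"
proof (rule ex_ex1I)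
  show "\<exists>r. eventually (\<lambda>x. x mod int n = r) u"
  proof (rule ccontr)
    assume "\<nexists>r. eventually (\<lambda>x. x mod int n = r) u"
    then have "eventually (\<lambda>x. x mod int n \<noteq> r) u" for r
      using ultrafilter_not_mem[OF u, of "{x. x mod int n = r}"] by simp
    then have "eventually (\<lambda>x. \<forall>r\<in>{0..<int n}. x mod int n \<noteq> r) u"
      by (intro eventually_ball_finite) auto
    moreover have "\<not> (\<forall>r\<in>{0..<int n}. x mod int n \<noteq> r)" for x
      using n by auto
    ultimately show False using u by (simp add: ultrafilter_def)
  qed
next
  fix r s assume "eventually (\<lambda>x. x mod int n = r) u" "eventually (\<lambda>x. x mod int n = s) u"
  then have "eventually (\<lambda>x. r = s) u" by eventually_elim simp
  then show "r = s" using u by (simp add: eventually_const ultrafilter_def)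
qed

text \<open>The image of \<open>u\<close> in the profinite integers. The restriction to positive
  moduli makes it extensional, as membership in a product group requires.\<close>

definition uf_residue :: "int filter \<Rightarrow> nat \<Rightarrow> int"
  where "uf_residue u = (\<lambda>n\<in>{n. n > 0}. THE r. eventually (\<lambda>x. x mod int n = r) u)"

lemma eventually_uf_residue:
  assumes "ultrafilter u" "n > 0"
  shows "eventually (\<lambda>x. x mod int n = uf_residue u n) u"
  using theI'[OF ultrafilter_ex1_residue[OF assms]] assms by (simp add: uf_residue_def)

lemma uf_residue_eqI:
  assumes "ultrafilter u" "n > 0" "eventually (\<lambda>x. x mod int n = r) u"
  shows "uf_residue u n = r"
  using ultrafilter_ex1_residue[OF assms(1,2)] eventually_uf_residue[OF assms(1,2)] assms(3) by blast

section \<open>Residues as a homomorphism from \<open>betaZ\<close> onto the profinite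
  integers\<close>

lemma Zhat_carrier_iff:
  "f \<in> carrier Zhat \<longleftrightarrow> f \<in> extensional {n. n > 0} \<and> (\<forall>n>0. 0 \<le> f n \<and> f n < int n) \<and>
     (\<forall>m n. n > 0 \<longrightarrow> m dvd n \<longrightarrow> f n mod int m = f m)"
  by (auto simp: Zhat_def invlim_Zmod_def PiE_iff carrier_integer_mod_group dvd_pos_nat)

lemma Zhat_mult: "f \<otimes>\<^bsub>Zhat\<^esub> g = (\<lambda>n\<in>{n. n > 0}. (f n + g n) mod int n)"
  by (simp add: Zhat_def invlim_Zmod_def)

lemma group_Zhat: "group Zhat"
  unfolding Zhat_def by (rule group_invlim_Zmod)

lemma uf_residue_Zhat:
  assumes u: "ultrafilter u"
  shows "uf_residue u \<in> carrier Zhat"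
  unfolding Zhat_carrier_iff
proof (intro conjI allI impI)
  show "uf_residue u \<in> extensional {n. n > 0}" by (simp add: uf_residue_def)
  fix n :: nat assume n: "n > 0"
  \<comment> \<open>The bounds do not involve \<open>x\<close>: what holds eventually along the
    proper filter \<open>u\<close> and is constant is true.\<close>
  have "eventually (\<lambda>x. 0 \<le> uf_residue u n \<and> uf_residue u n < int n) u"
    using eventually_uf_residue[OF u n] by eventually_elim (metis n of_nat_0_less_iff pos_mod_bound pos_mod_sign)
  then show "0 \<le> uf_residue u n" "uf_residue u n < int n"
    using u by (simp_all add: eventually_const ultrafilter_def)
  fix m assume m: "m dvd n"
  have "eventually (\<lambda>x. x mod int m = uf_residue u n mod int m) u"
    using eventually_uf_residue[OF u n]
    by eventually_elim (use m in \<open>metis mod_mod_cancel of_nat_dvd_iff\<close>)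
  then show "uf_residue u n mod int m = uf_residue u m"
    using uf_residue_eqI[OF u dvd_pos_nat[OF n m]] by simp
qed

lemma uf_residue_plus:
  assumes u: "ultrafilter u" and v: "ultrafilter v" and n: "n > 0"
  shows "uf_residue (uf_plus u v) n = (uf_residue u n + uf_residue v n) mod int n"
proof (rule uf_residue_eqI[OF ultrafilter_uf_plus[OF u v] n])
  let ?A = "{x. x mod int n = (uf_residue u n + uf_residue v n) mod int n}"
  have "{y. x + y \<in> ?A} \<in>\<^sub>F v" if "x mod int n = uf_residue u n" for x
    using eventually_uf_residue[OF v n]
  proof eventually_elim
    case (elim y)
    then show ?case using that mod_add_eq[of x "int n" y] by simp
  qed
  then have "{x. {y. x + y \<in> ?A} \<in>\<^sub>F v} \<in>\<^sub>F u"
    by (intro eventually_mono[OF eventually_uf_residue[OF u n]]) blast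
  then have "?A \<in>\<^sub>F uf_plus u v" by (simp only: mem_uf_plus)
  then show "eventually (\<lambda>x. x mod int n = (uf_residue u n + uf_residue v n) mod int n) (uf_plus u v)"
    by simp
qed

lemma uf_residue_hom: "uf_residue \<in> hom betaZ Zhat"
proof (rule homI)
  fix u v assume "u \<in> carrier betaZ" "v \<in> carrier betaZ"
  then have uv: "ultrafilter u" "ultrafilter v" by (auto simp: betaZ_def)
  have "uf_residue (uf_plus u v) = (\<lambda>n\<in>{n. n > 0}. (uf_residue u n + uf_residue v n) mod int n)"
    by (rule ext) (use uv in \<open>auto simp: uf_residue_plus, simp add: uf_residue_def\<close>)
  then show "uf_residue (u \<otimes>\<^bsub>betaZ\<^esub> v) = uf_residue u \<otimes>\<^bsub>Zhat\<^esub> uf_residue v"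
    by (simp add: Zhat_mult betaZ_def)
qed (simp add: betaZ_def uf_residue_Zhat)

text \<open>A compactness argument: the residue classes prescribed by \<open>f\<close> have the
  finite intersection property, and any ultrafilter containing all of them is mapped to
  \<open>f\<close>.\<close>

lemma uf_residue_surj: "uf_residue ` carrier betaZ = carrier Zhat"
proof (intro equalityI subsetI)
  fix f assume f: "f \<in> carrier Zhat"
  define B where "B n = {x. x mod int n = f n}" for n
  have "\<Inter>\<F> \<noteq> {}" if fin: "finite \<F>" and sub: "\<F> \<subseteq> B ` {n. n > 0}" for \<F>
  proof -
    obtain N where N: "finite N" "N \<subseteq> {n. n > 0}" "\<F> = B ` N"
      using finite_subset_image[OF fin sub] by blast
    \<comment> \<open>The common point of finitely many classes is the residue of \<open>f\<close>
      at the product of the moduli, by coherence of \<open>f\<close>.\<close>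
    have "f (\<Prod>N) \<in> B n" if "n \<in> N" for n
    proof -
      have "\<Prod>N > 0" using N(2) by (intro prod_pos) auto
      moreover have "n dvd \<Prod>N" using dvd_prodI[OF N(1) that, of id] by simp
      ultimately show ?thesis using f by (auto simp: B_def Zhat_carrier_iff)
    qed
    then show ?thesis by (auto simp: N(3))
  qed
  then obtain u where u: "ultrafilter u" "\<And>A. A \<in> B ` {n. n > 0} \<Longrightarrow> A \<in>\<^sub>F u"
    using ultrafilter_finite_intersections[of "B ` {n. n > 0}"] by blast
  have "uf_residue u n = f n" for n
  proof (cases "n > 0")
    case True
    then have "B n \<in>\<^sub>F u" using u(2) by blast
    then show ?thesis by (intro uf_residue_eqI[OF u(1) True]) (simp add: B_def)
  next
    \<comment> \<open>At the index \<open>0\<close> both functions are \<open>undefined\<close>,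
      being extensional.\<close>
    case False
    then show ?thesis using f by (auto simp: uf_residue_def Zhat_carrier_iff extensional_def)
  qed
  then have "f = uf_residue u" by auto
  then show "f \<in> uf_residue ` carrier betaZ" using u(1) by (auto simp: betaZ_def)
qed (auto simp: betaZ_def uf_residue_Zhat)

text \<open>The left side says that, for \<open>u\<close>-almost all \<open>x\<close> and then
  \<open>v\<close>-almost all \<open>y\<close>, \<open>m\<close> divides \<open>x - y\<close>. Along
  \<open>v\<close> and then along \<open>u\<close>, the residues of \<open>y\<close> and
  \<open>x\<close> may be replaced by constants. The absolute value turns an integer modulus into a
  positive natural index.\<close>

lemma multiples_mem_uf_minus_iff:
  assumes u: "ultrafilter u" and v: "ultrafilter v" and m: "m \<noteq> 0"
  shows "multiples m \<in>\<^sub>F uf_minus u v \<longleftrightarrow> uf_residue u (nat \<bar>m\<bar>) = uf_residue v (nat \<bar>m\<bar>)"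
proof -
  let ?n = "nat \<bar>m\<bar>"
  have n: "?n > 0" using m by simp
  have v': "{y. x + y \<in> multiples m} \<in>\<^sub>F uf_uminus v \<longleftrightarrow> x mod int ?n = uf_residue v ?n" for x
  proof -
    have "eventually (\<lambda>y. x - y \<in> multiples m \<longleftrightarrow> x mod int ?n = uf_residue v ?n) v"
      using eventually_uf_residue[OF v n]
    proof eventually_elim
      case (elim y)
      have "x - y \<in> multiples m \<longleftrightarrow> m dvd x - y" by (auto simp: dvd_def)
      also have "\<dots> \<longleftrightarrow> int ?n dvd x - y" by simp
      also have "\<dots> \<longleftrightarrow> x mod int ?n = y mod int ?n" by (simp only: mod_eq_dvd_iff)
      finally show ?case using elim by simp
    qed
    from ultrafilter_eventually_iff_const[OF v this] show ?thesis
      by (simp add: uf_uminus_def eventually_filtermap)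
  qed
  have "eventually (\<lambda>x. x mod int ?n = uf_residue v ?n \<longleftrightarrow> uf_residue u ?n = uf_residue v ?n) u"
    using eventually_uf_residue[OF u n] by eventually_elim simp
  from ultrafilter_eventually_iff_const[OF u this] show ?thesis
    unfolding uf_minus_def mem_uf_plus v' by simp
qed

text \<open>The relation on the profinite integers that \<open>strong_cong w\<close> becomes under
  \<open>uf_residue\<close>; both target groups are compared with it.\<close>

definition Zhat_agree :: "int filter \<Rightarrow> (nat \<Rightarrow> int) \<Rightarrow> (nat \<Rightarrow> int) \<Rightarrow> bool"
  where "Zhat_agree w f g \<longleftrightarrow> {n \<in> UNIV - {0}. f (nat \<bar>n\<bar>) = g (nat \<bar>n\<bar>)} \<in>\<^sub>F w"

text \<open>The translation into residues is available at nonzero moduli, and these form a set in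
  \<open>w\<close>.\<close>

lemma strong_cong_eq_Zhat_agree:
  assumes nz: "UNIV - {0} \<in>\<^sub>F w"
  shows "strong_cong w = {(u, v). u \<in> carrier betaZ \<and> v \<in> carrier betaZ \<and>
           Zhat_agree w (uf_residue u) (uf_residue v)}"
proof -
  have "{n. multiples n \<in>\<^sub>F uf_minus u v} \<in>\<^sub>F w \<longleftrightarrow> Zhat_agree w (uf_residue u) (uf_residue v)"
    if "ultrafilter u" "ultrafilter v" for u v
    unfolding Zhat_agree_def
    by (rule eventually_subst, rule eventually_mono[OF nz])
      (simp add: multiples_mem_uf_minus_iff[OF that])
  then show ?thesis by (auto simp: strong_cong_def betaZ_def)
qed

text \<open>Common reduction for both halves of the theorem: a surjective homomorphism from
  \<open>Zhat\<close> whose fibres are the classes of \<open>Zhat_agree w\<close> is composed with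
  \<open>uf_residue\<close>, and the isomorphism theorem is applied.\<close>

lemma quotient_betaZ_iso:
  assumes nz: "UNIV - {0} \<in>\<^sub>F w" and h: "h \<in> hom Zhat K" and onto: "h ` carrier Zhat = carrier K"
    and eq: "\<And>f g. f \<in> carrier Zhat \<Longrightarrow> g \<in> carrier Zhat \<Longrightarrow> h f = h g \<longleftrightarrow> Zhat_agree w f g"
  shows "quotient_monoid betaZ (strong_cong w) \<cong> K"
proof (rule hom_imp_quotient_monoid_iso)
  show "h \<circ> uf_residue \<in> hom betaZ K"
    by (rule hom_compose[OF uf_residue_hom h])
  show "(h \<circ> uf_residue) ` carrier betaZ = carrier K"
    unfolding image_comp[symmetric] uf_residue_surj by (rule onto)
  show "strong_cong w = {(u, v). u \<in> carrier betaZ \<and> v \<in> carrier betaZ \<and>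
      (h \<circ> uf_residue) u = (h \<circ> uf_residue) v}"
    unfolding strong_cong_eq_Zhat_agree[OF nz]
    using eq uf_residue_Zhat by (auto simp: betaZ_def)
qed (simp add: betaZ_def ultrafilter_uf_plus)


section \<open>The map to the ultraproduct\<close>

text \<open>Names the congruence by which \<open>ultraproduct_Zmod w\<close> is formed as a quotient
  of the full product.\<close>

definition ultraproduct_rel :: "int filter \<Rightarrow> ((int \<Rightarrow> int) \<times> (int \<Rightarrow> int)) set"
  where "ultraproduct_rel w =
    (let C = carrier (product_group (UNIV - {0}) (\<lambda>n::int. integer_mod_group (nat \<bar>n\<bar>)))
     in {(f, g). f \<in> C \<and> g \<in> C \<and> {n \<in> UNIV - {0}. f n = g n} \<in>\<^sub>F w})"

text \<open>The canonical map: all residues are kept, and then identified along \<open>w\<close>.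
  Indices \<open>n\<close> and \<open>- n\<close> carry the same residue because they carry the same
  group.\<close>

definition Zhat_to_ultraproduct :: "int filter \<Rightarrow> (nat \<Rightarrow> int) \<Rightarrow> (int \<Rightarrow> int) set"
  where "Zhat_to_ultraproduct w f = ultraproduct_rel w `` {\<lambda>n\<in>UNIV - {0}. f (nat \<bar>n\<bar>)}"

lemma Zhat_spread_carrier:
  assumes "f \<in> carrier Zhat"
  shows "(\<lambda>n\<in>UNIV - {0}. f (nat \<bar>n\<bar>))
    \<in> carrier (product_group (UNIV - {0}) (\<lambda>n::int. integer_mod_group (nat \<bar>n\<bar>)))"
proof -
  have "f (nat \<bar>n\<bar>) \<in> carrier (integer_mod_group (nat \<bar>n\<bar>))" if "n \<noteq> 0" for n
  proof -
    have "nat \<bar>n\<bar> > 0" using that by simp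
    moreover have "0 \<le> f (nat \<bar>n\<bar>)" "f (nat \<bar>n\<bar>) < int (nat \<bar>n\<bar>)"
      using assms calculation unfolding Zhat_carrier_iff by blast+
    ultimately show ?thesis by (simp add: carrier_integer_mod_group)
  qed
  then show ?thesis by auto
qed

lemma equiv_ultraproduct_rel:
  assumes nz: "UNIV - {0} \<in>\<^sub>F w"
  shows "equiv (carrier (product_group (UNIV - {0}) (\<lambda>n::int. integer_mod_group (nat \<bar>n\<bar>))))
    (ultraproduct_rel w)"
  unfolding ultraproduct_rel_def Let_def by (rule equiv_ultraproduct[OF nz])

lemma Zhat_to_ultraproduct_eq_iff:
  assumes nz: "UNIV - {0} \<in>\<^sub>F w" and fg: "f \<in> carrier Zhat" "g \<in> carrier Zhat"
  shows "Zhat_to_ultraproduct w f = Zhat_to_ultraproduct w g \<longleftrightarrow> Zhat_agree w f g"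
proof -
  let ?s = "\<lambda>f. \<lambda>n\<in>UNIV - {0}. f (nat \<bar>n::int\<bar>) :: int"
  have "Zhat_to_ultraproduct w f = Zhat_to_ultraproduct w g \<longleftrightarrow> (?s f, ?s g) \<in> ultraproduct_rel w"
    unfolding Zhat_to_ultraproduct_def
    by (rule eq_equiv_class_iff[OF equiv_ultraproduct_rel[OF nz]]) (intro Zhat_spread_carrier fg)+
  also have "\<dots> \<longleftrightarrow> {n \<in> UNIV - {0}. ?s f n = ?s g n} \<in>\<^sub>F w"
    unfolding ultraproduct_rel_def Let_def using fg[THEN Zhat_spread_carrier] by blast
  also have "{n \<in> UNIV - {0}. ?s f n = ?s g n} = {n \<in> UNIV - {0}. f (nat \<bar>n\<bar>) = g (nat \<bar>n\<bar>)}"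
    by auto
  finally show ?thesis by (simp only: Zhat_agree_def)
qed

text \<open>The map is spreading over the nonzero indices followed by passage to classes, and each
  of the two is a homomorphism.\<close>

lemma Zhat_to_ultraproduct_hom:
  assumes nz: "UNIV - {0} \<in>\<^sub>F w"
  shows "Zhat_to_ultraproduct w \<in> hom Zhat (ultraproduct_Zmod w)"
proof -
  let ?P = "product_group (UNIV - {0}) (\<lambda>n::int. integer_mod_group (nat \<bar>n\<bar>))"
  let ?s = "\<lambda>f. \<lambda>n\<in>UNIV - {0}. f (nat \<bar>n::int\<bar>) :: int"
  have P: "group ?P" by (rule product_group) simp
  have ultra: "ultraproduct_Zmod w = quotient_monoid ?P (ultraproduct_rel w)"
    by (simp only: ultraproduct_Zmod_def ultraproduct_group_def ultraproduct_rel_def Let_def)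
  have "?s \<in> hom Zhat ?P"
  proof (rule homI)
    fix f g
    show "?s (f \<otimes>\<^bsub>Zhat\<^esub> g) = ?s f \<otimes>\<^bsub>?P\<^esub> ?s g"
      by (auto simp: Zhat_mult)
  qed (rule Zhat_spread_carrier)
  moreover have "(\<lambda>a. ultraproduct_rel w `` {a}) \<in> hom ?P (ultraproduct_Zmod w)"
    unfolding ultra
  proof (rule quotient_monoid_class_hom[OF equiv_ultraproduct_rel[OF nz]])
    fix a a' b b'
    assume r: "(a, a') \<in> ultraproduct_rel w" "(b, b') \<in> ultraproduct_rel w"
    then have c: "a \<in> carrier ?P" "a' \<in> carrier ?P" "b \<in> carrier ?P" "b' \<in> carrier ?P"
      unfolding ultraproduct_rel_def Let_def by blast+
    have "eventually (\<lambda>n. n \<in> {n \<in> UNIV - {0}. a n = a' n}) w"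
      "eventually (\<lambda>n. n \<in> {n \<in> UNIV - {0}. b n = b' n}) w"
      using r unfolding ultraproduct_rel_def Let_def by blast+
    then have "eventually (\<lambda>n. n \<in> {n \<in> UNIV - {0}. (a \<otimes>\<^bsub>?P\<^esub> b) n = (a' \<otimes>\<^bsub>?P\<^esub> b') n}) w"
      by eventually_elim simp
    then show "(a \<otimes>\<^bsub>?P\<^esub> b, a' \<otimes>\<^bsub>?P\<^esub> b') \<in> ultraproduct_rel w"
      unfolding ultraproduct_rel_def Let_def
      using c monoid.m_closed[OF group.is_monoid[OF P]] by blast
  qed
  ultimately show ?thesis
    using hom_compose[of ?s Zhat ?P "\<lambda>a. ultraproduct_rel w `` {a}" "ultraproduct_Zmod w"]
    by (simp only: Zhat_to_ultraproduct_def[abs_def] comp_def)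
qed


section \<open>Prime powers\<close>

text \<open>Comparison of multiplicities, with \<open>pp\<close> applied to the highest power of
  each prime in \<open>n\<close>. The case \<open>d = 0\<close> is separate because
  \<open>multiplicity p 0\<close> is \<open>0\<close> rather than infinite.\<close>

lemma int_dvd_if_prime_powers_dvd:
  assumes n: "n > 0" and pp: "\<And>p k. prime p \<Longrightarrow> p ^ k dvd n \<Longrightarrow> int (p ^ k) dvd d"
  shows "int n dvd d"
proof (cases "d = 0")
  case False
  have "n dvd nat \<bar>d\<bar>"
  proof (rule multiplicity_le_imp_dvd)
    fix p :: nat assume p: "prime p"
    have "int (p ^ multiplicity p n) dvd d" by (rule pp[OF p multiplicity_dvd])
    then have "p ^ multiplicity p n dvd nat \<bar>d\<bar>" by (simp add: nat_dvd_iff flip: of_nat_power)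
    then show "multiplicity p n \<le> multiplicity p (nat \<bar>d\<bar>)"
      using False p by (intro multiplicity_geI) auto
  qed (use n in simp)
  then show ?thesis by simp
qed simp

text \<open>Uniqueness half of the Chinese remainder theorem: coherence gives congruence of
  \<open>f n\<close> and \<open>g n\<close> modulo each prime power dividing \<open>n\<close>, hence
  modulo \<open>n\<close>, and both are already reduced.\<close>

lemma Zhat_eq_if_prime_powers_eq:
  assumes fg: "f \<in> carrier Zhat" "g \<in> carrier Zhat" and n: "n > 0"
    and eq: "\<And>p k. prime p \<Longrightarrow> p ^ k dvd n \<Longrightarrow> f (p ^ k) = g (p ^ k)"
  shows "f n = g n"
proof -
  have "int n dvd f n - g n"
  proof (rule int_dvd_if_prime_powers_dvd[OF n])
    fix p k :: nat assume "prime p" "p ^ k dvd n"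
    then have "f n mod int (p ^ k) = g n mod int (p ^ k)"
      using fg n eq by (simp add: Zhat_carrier_iff del: of_nat_power)
    then show "int (p ^ k) dvd f n - g n" by (simp only: mod_eq_dvd_iff)
  qed
  then have "f n mod int n = g n mod int n" by (simp only: mod_eq_dvd_iff)
  then show ?thesis using fg n by (simp add: Zhat_carrier_iff)
qed

text \<open>Existence half of the Chinese remainder theorem. For each \<open>n\<close> a solution is
  found for the highest prime powers dividing \<open>n\<close>; coherence of \<open>a\<close> then
  handles the lower powers.\<close>

lemma Zhat_from_prime_powers:
  assumes a: "\<And>p i j. prime p \<Longrightarrow> i \<le> j \<Longrightarrow> a p j mod int (p ^ i) = a p i"
  obtains f where "f \<in> carrier Zhat" "\<And>p k. prime p \<Longrightarrow> f (p ^ k) = a p k"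
proof -
  \<comment> \<open>With \<open>i = j\<close> the hypothesis says that \<open>a p k\<close> is its
    own residue. Nonnegativity allows the passage through \<open>nat\<close> in the remainder
    theorem for naturals.\<close>
  have a_range: "0 \<le> a p k" "a p k < int (p ^ k)" if p: "prime p" for p k
  proof -
    have "int (p ^ k) > 0" using p by (simp add: prime_gt_0_nat)
    then have "0 \<le> a p k mod int (p ^ k)" "a p k mod int (p ^ k) < int (p ^ k)" by simp_all
    then show "0 \<le> a p k" "a p k < int (p ^ k)" using a[OF p, of k k] by simp_all
  qed
  have "\<exists>x::int. \<forall>p k. prime p \<longrightarrow> p ^ k dvd n \<longrightarrow> x mod int (p ^ k) = a p k" if n: "n > 0" for n :: nat
  proof -
    have "\<exists>x. \<forall>p\<in>prime_factors n. [x = nat (a p (multiplicity p n))] (mod p ^ multiplicity p n)"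
      by (rule chinese_remainder_nat) (simp_all add: primes_coprime in_prime_factors_imp_prime)
    then obtain x where x: "\<And>p. p \<in> prime_factors n \<Longrightarrow>
        [x = nat (a p (multiplicity p n))] (mod p ^ multiplicity p n)" by blast
    have "int x mod int (p ^ k) = a p k" if p: "prime p" and k: "p ^ k dvd n" for p k
    proof (cases "k = 0")
      \<comment> \<open>For \<open>k = 0\<close> the prime need not divide \<open>n\<close>; both
        sides are \<open>0\<close>.\<close>
      case True
      then show ?thesis using a_range[OF p, of 0] by simp
    next
      case False
      have "p dvd n" using k False dvd_power[of k p] dvd_trans by blast
      then have "p \<in> prime_factors n" using p n by (simp add: in_prime_factors_iff)
      from x[OF this]
      have "[int x = int (nat (a p (multiplicity p n)))] (mod int (p ^ multiplicity p n))"
        by (simp only: cong_int_iff)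
      then have "[int x = a p (multiplicity p n)] (mod int (p ^ multiplicity p n))"
        using a_range[OF p] by simp
      moreover have km: "k \<le> multiplicity p n"
        using n p k by (intro multiplicity_geI) auto
      ultimately have "[int x = a p (multiplicity p n)] (mod int (p ^ k))"
        by (meson cong_dvd_modulus le_imp_power_dvd of_nat_dvd_iff)
      then show ?thesis using a[OF p km] by (simp add: cong_def)
    qed
    then show ?thesis by blast
  qed
  then obtain X where X: "\<And>n p k. n > 0 \<Longrightarrow> prime p \<Longrightarrow> p ^ k dvd n \<Longrightarrow> X n mod int (p ^ k) = a p k"
    by metis
  define f where "f = (\<lambda>n\<in>{n. n > 0}. X n mod int n)"
  have "f \<in> carrier Zhat"
    unfolding Zhat_carrier_iff
  proof (intro conjI allI impI)
    fix m n :: nat assume n: "n > 0" and m: "m dvd n"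
    then have m0: "m > 0" by (rule dvd_pos_nat)
    \<comment> \<open>The solutions \<open>X n\<close> and \<open>X m\<close> were chosen
      independently, but they agree modulo each prime power dividing \<open>m\<close>, hence modulo
      \<open>m\<close>.\<close>
    have "int m dvd X n - X m"
    proof (rule int_dvd_if_prime_powers_dvd[OF m0])
      fix p k :: nat assume "prime p" "p ^ k dvd m"
      then have "X n mod int (p ^ k) = X m mod int (p ^ k)"
        using X m m0 n dvd_trans by metis
      then show "int (p ^ k) dvd X n - X m" by (simp only: mod_eq_dvd_iff)
    qed
    then have "X n mod int m = X m mod int m" by (simp only: mod_eq_dvd_iff)
    then show "f n mod int m = f m" using n m m0 by (simp add: f_def mod_mod_cancel)
  qed (auto simp: f_def)
  moreover have "f (p ^ k) = a p k" if "prime p" for p k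
    using X[of "p ^ k" p k] that by (simp add: f_def prime_gt_0_nat)
  ultimately show thesis by (rule that)
qed

text \<open>The set \<open>K\<close> of admissible exponents contains \<open>0\<close> and is
  downward closed, so it is determined by its maximum, or is everything if there is none.\<close>

lemma multiples_prime_power_mem_iff:
  "multiples (int p ^ k) \<in>\<^sub>F w \<longleftrightarrow> enat k \<le> phi w p"
proof -
  define K where "K = {k. multiples (int p ^ k) \<in>\<^sub>F w}"
  have down: "j \<in> K" if "k \<in> K" "j \<le> k" for j k
  proof -
    have "multiples (int p ^ k) \<subseteq> multiples (int p ^ j)"
      using le_imp_power_dvd[OF that(2), of "int p"] by (auto simp: dvd_def mult.assoc)
    then show ?thesis
      using that(1) unfolding K_def mem_Collect_eq by (meson eventually_mono subsetD)
  qed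
  have phi: "phi w p = (if \<exists>k\<in>K. \<forall>j\<in>K. j \<le> k then enat (GREATEST k. k \<in> K) else \<infinity>)"
    by (simp add: phi_def K_def Let_def)
  have "k \<in> K \<longleftrightarrow> enat k \<le> phi w p"
  proof (cases "\<exists>m\<in>K. \<forall>j\<in>K. j \<le> m")
    case True
    then obtain m where m: "m \<in> K" "\<forall>j\<in>K. j \<le> m" by blast
    then have "(GREATEST k. k \<in> K) = m" by (intro Greatest_equality) auto
    then have "phi w p = enat m" using True by (simp only: phi if_True)
    moreover have "k \<in> K \<longleftrightarrow> k \<le> m" using m down by blast
    ultimately show ?thesis by simp
  next
    case False
    have "0 \<in> K" by (simp add: K_def)
    \<comment> \<open>Without a maximum \<open>K\<close> is unbounded: by induction, a member at
      least \<open>k\<close> is exceeded by another member, which is at least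
      \<open>Suc k\<close>.\<close>
    then have "\<exists>j\<in>K. k \<le> j"
      using False
    proof (induction k)
      case (Suc k)
      then obtain j where "j \<in> K" "k \<le> j" by blast
      with Suc.prems(2) show ?case by (meson not_less_eq_eq order_trans leI)
    qed blast
    then have "k \<in> K" using down by blast
    moreover have "phi w p = \<infinity>" using False by (simp only: phi if_False)
    ultimately show ?thesis by simp
  qed
  then show ?thesis by (simp add: K_def)
qed

text \<open>Replaces agreement at almost all moduli by the finer coordinates that the local factors
  can see.\<close>

lemma Zhat_agree_iff_prime_powers:
  assumes w: "ultrafilter w" "UNIV - {0} \<in>\<^sub>F w" and sd: "self_divisible w"
    and fg: "f \<in> carrier Zhat" "g \<in> carrier Zhat"
  shows "Zhat_agree w f g \<longleftrightarrow> (\<forall>p k. prime p \<longrightarrow> enat k \<le> phi w p \<longrightarrow> f (p ^ k) = g (p ^ k))"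
proof
  assume agree: "Zhat_agree w f g"
  show "\<forall>p k. prime p \<longrightarrow> enat k \<le> phi w p \<longrightarrow> f (p ^ k) = g (p ^ k)"
  proof (intro allI impI)
    fix p k assume "enat k \<le> phi w p"
    then have "multiples (int p ^ k) \<in>\<^sub>F w" by (simp only: multiples_prime_power_mem_iff)
    then have "eventually (\<lambda>n. n \<in> {n \<in> UNIV - {0}. f (nat \<bar>n\<bar>) = g (nat \<bar>n\<bar>)} \<and>
        n \<in> multiples (int p ^ k)) w"
      using agree unfolding Zhat_agree_def by (intro eventually_conj)
    \<comment> \<open>A set in \<open>w\<close> is nonempty, so some nonzero multiple
      \<open>n\<close> of \<open>p ^ k\<close> has agreeing residues; these are then reduced modulo
      \<open>p ^ k\<close>.\<close>
    from eventually_happens'[OF _ this] obtain n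
      where "n \<in> {n \<in> UNIV - {0}. f (nat \<bar>n\<bar>) = g (nat \<bar>n\<bar>)} \<and> n \<in> multiples (int p ^ k)"
      using w(1) by (auto simp only: ultrafilter_def)
    then have n: "n \<noteq> 0" "f (nat \<bar>n\<bar>) = g (nat \<bar>n\<bar>)" "n \<in> multiples (int p ^ k)"
      by simp_all
    from n(3) have "p ^ k dvd nat \<bar>n\<bar>" by (auto simp: abs_mult nat_mult_distrib nat_power_eq)
    moreover have "nat \<bar>n\<bar> > 0" using n(1) by simp
    ultimately have "f (nat \<bar>n\<bar>) mod int (p ^ k) = f (p ^ k)" "g (nat \<bar>n\<bar>) mod int (p ^ k) = g (p ^ k)"
      using fg unfolding Zhat_carrier_iff by blast+
    then show "f (p ^ k) = g (p ^ k)" using n(2) by simp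
  qed
next
  assume eq: "\<forall>p k. prime p \<longrightarrow> enat k \<le> phi w p \<longrightarrow> f (p ^ k) = g (p ^ k)"
  have "divisors_uf w \<in>\<^sub>F w" using sd by (simp add: self_divisible_def)
  with w(2) show "Zhat_agree w f g"
    unfolding Zhat_agree_def
  proof eventually_elim
    case (elim n)
    have "f (nat \<bar>n\<bar>) = g (nat \<bar>n\<bar>)"
    proof (rule Zhat_eq_if_prime_powers_eq[OF fg])
      show "nat \<bar>n\<bar> > 0" using elim by simp
      fix p k :: nat assume p: "prime p" and k: "p ^ k dvd nat \<bar>n\<bar>"
      have "int (p ^ k) dvd n" using k by (metis dvd_abs_iff int_nat_eq abs_ge_zero of_nat_dvd_iff)
      \<comment> \<open>Self-divisibility acts here: \<open>n\<close> lies in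
        \<open>divisors_uf w\<close>, so \<open>multiples n\<close>, and with it the larger set
        \<open>multiples (int p ^ k)\<close>, belongs to \<open>w\<close>.\<close>
      then have "multiples n \<subseteq> multiples (int p ^ k)" by (auto simp: dvd_def mult.assoc)
      then have "multiples (int p ^ k) \<in>\<^sub>F w"
        using elim unfolding divisors_uf_def mem_Collect_eq by (meson eventually_mono subsetD)
      then show "f (p ^ k) = g (p ^ k)" using eq p by (simp only: multiples_prime_power_mem_iff)
    qed
    then show ?case using elim by simp
  qed
qed


section \<open>The map to the product of the local factors\<close>

lemma image_group_hom:
  assumes "inj_on f (carrier G)"
  shows "f \<in> hom G (image_group f G)"
  using assms by (intro homI) (auto simp: image_group_def inv_into_f_f)

text \<open>At each prime this is the projection of \<open>Zhat\<close> to the local factor: a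
  single residue if \<open>phi w p\<close> is finite, the residues at all powers of \<open>p\<close>
  otherwise. The tags match those in \<open>local_factor\<close>.\<close>

definition Zhat_local :: "int filter \<Rightarrow> (nat \<Rightarrow> int) \<Rightarrow> nat \<Rightarrow> int + (nat \<Rightarrow> int)"
  where "Zhat_local w f = (\<lambda>p\<in>{p. prime p}.
    case phi w p of enat k \<Rightarrow> Inl (f (p ^ k)) | \<infinity> \<Rightarrow> Inr (restrict f (range (\<lambda>k. p ^ k))))"

lemma Zp_carrier_iff:
  assumes p: "p > 0"
  shows "f \<in> carrier (Zp p) \<longleftrightarrow> f \<in> extensional (range (\<lambda>k. p ^ k)) \<and>
    (\<forall>k. 0 \<le> f (p ^ k) \<and> f (p ^ k) < int (p ^ k)) \<and>
    (\<forall>i j. p ^ i dvd p ^ j \<longrightarrow> f (p ^ j) mod int (p ^ i) = f (p ^ i))"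
  using p by (auto simp: Zp_def invlim_Zmod_def PiE_iff carrier_integer_mod_group)

lemma Zhat_reduce_hom:
  assumes "n > 0"
  shows "(\<lambda>f. f n) \<in> hom Zhat (integer_mod_group n)"
  using assms by (intro homI) (auto simp: Zhat_mult Zhat_carrier_iff carrier_integer_mod_group)

lemma Zhat_restrict_hom:
  assumes p: "p > 0"
  shows "(\<lambda>f. restrict f (range (\<lambda>k. p ^ k))) \<in> hom Zhat (Zp p)"
proof (rule homI)
  fix f assume "f \<in> carrier Zhat"
  then show "restrict f (range (\<lambda>k. p ^ k)) \<in> carrier (Zp p)"
    using p by (auto simp: Zp_carrier_iff Zhat_carrier_iff simp flip: of_nat_power)
next
  fix f g
  show "restrict (f \<otimes>\<^bsub>Zhat\<^esub> g) (range (\<lambda>k. p ^ k)) =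
      restrict f (range (\<lambda>k. p ^ k)) \<otimes>\<^bsub>Zp p\<^esub> restrict g (range (\<lambda>k. p ^ k))"
    using p by (auto simp: fun_eq_iff restrict_def Zhat_mult Zp_def invlim_Zmod_def)
qed

lemma Zhat_local_hom: "Zhat_local w \<in> hom Zhat (product_group {p. prime p} (local_factor w))"
proof -
  have hom: "(\<lambda>f. Zhat_local w f p) \<in> hom Zhat (local_factor w p)" if p: "prime p" for p
  proof (cases "phi w p")
    case (enat k)
    have "Inl \<circ> (\<lambda>f. f (p ^ k)) \<in> hom Zhat (image_group Inl (integer_mod_group (p ^ k)))"
      using p by (intro hom_compose[OF Zhat_reduce_hom image_group_hom]) (auto simp: prime_gt_0_nat)
    then show ?thesis using enat p by (simp add: Zhat_local_def local_factor_def comp_def)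
  next
    case infinity
    have "Inr \<circ> (\<lambda>f. restrict f (range (\<lambda>k. p ^ k))) \<in> hom Zhat (image_group Inr (Zp p))"
      using p by (intro hom_compose[OF Zhat_restrict_hom image_group_hom]) (auto simp: prime_gt_0_nat)
    then show ?thesis using infinity p by (simp add: Zhat_local_def local_factor_def comp_def)
  qed
  show ?thesis
  proof (rule homI)
    fix f assume "f \<in> carrier Zhat"
    then show "Zhat_local w f \<in> carrier (product_group {p. prime p} (local_factor w))"
      using hom_in_carrier[OF hom] by (auto simp: PiE_iff) (simp add: Zhat_local_def)
  next
    fix f g assume "f \<in> carrier Zhat" "g \<in> carrier Zhat"
    then show "Zhat_local w (f \<otimes>\<^bsub>Zhat\<^esub> g) =
        Zhat_local w f \<otimes>\<^bsub>product_group {p. prime p} (local_factor w)\<^esub> Zhat_local w g"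
      using hom_mult[OF hom] by (intro ext) (auto simp: restrict_def, simp add: Zhat_local_def)
  qed
qed

text \<open>For \<open>phi w p = enat m\<close> only the residue at \<open>p ^ m\<close> is
  recorded, and by coherence it determines those at lower powers; for \<open>\<infinity>\<close> all
  powers are recorded.\<close>

lemma Zhat_local_eq_iff:
  assumes fg: "f \<in> carrier Zhat" "g \<in> carrier Zhat"
  shows "Zhat_local w f = Zhat_local w g \<longleftrightarrow>
    (\<forall>p k. prime p \<longrightarrow> enat k \<le> phi w p \<longrightarrow> f (p ^ k) = g (p ^ k))"
proof -
  have coherent: "h (p ^ j) mod int (p ^ i) = h (p ^ i)"
    if "h \<in> carrier Zhat" "prime p" "i \<le> j" for h p i j
    using that by (auto simp: Zhat_carrier_iff prime_gt_0_nat le_imp_power_dvd simp flip: of_nat_power)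
  have "Zhat_local w f p = Zhat_local w g p \<longleftrightarrow> (\<forall>k. enat k \<le> phi w p \<longrightarrow> f (p ^ k) = g (p ^ k))"
    if p: "prime p" for p
  proof (cases "phi w p")
    case (enat m)
    show ?thesis
    proof
      assume "Zhat_local w f p = Zhat_local w g p"
      then have "f (p ^ m) = g (p ^ m)" using p enat by (simp add: Zhat_local_def)
      then show "\<forall>k. enat k \<le> phi w p \<longrightarrow> f (p ^ k) = g (p ^ k)"
        using coherent[OF fg(1) p] coherent[OF fg(2) p] enat by (metis enat_ord_simps(1))
    qed (use p enat in \<open>simp add: Zhat_local_def\<close>)
  next
    case infinity
    then show ?thesis using p by (simp add: Zhat_local_def restrict_def fun_eq_iff) blast
  qed
  moreover have "Zhat_local w f p = Zhat_local w g p" if "\<not> prime p" for p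
    using that by (simp add: Zhat_local_def)
  ultimately show ?thesis unfolding fun_eq_iff by blast
qed

text \<open>The coordinates of a point of the product are extended to a coherent family of residues
  at all prime powers, which \<open>Zhat_from_prime_powers\<close> realises by one profinite
  integer.\<close>

lemma Zhat_local_surj:
  "Zhat_local w ` carrier Zhat = carrier (product_group {p. prime p} (local_factor w))"
proof (intro equalityI subsetI)
  fix y assume "y \<in> Zhat_local w ` carrier Zhat"
  then show "y \<in> carrier (product_group {p. prime p} (local_factor w))"
    using hom_in_carrier[OF Zhat_local_hom] by blast
next
  fix y assume y: "y \<in> carrier (product_group {p. prime p} (local_factor w))"
  then have yp: "y p \<in> carrier (local_factor w p)" if "prime p" for p
    using that by auto
  \<comment> \<open>Beyond level \<open>phi w p\<close> any coherent lift will do; the residues of the integer \<open>c\<close> are one.\<close>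
  define a where "a p k = (case y p of Inl c \<Rightarrow> c mod int (p ^ k) | Inr z \<Rightarrow> z (p ^ k))" for p k
  have coherent: "a p j mod int (p ^ i) = a p i" if p: "prime p" and ij: "i \<le> j" for p i j
  proof (cases "phi w p")
    case (enat k)
    then obtain c where "y p = Inl c"
      using yp[OF p] by (auto simp: local_factor_def image_group_carrier)
    then show ?thesis using ij by (simp add: a_def mod_mod_cancel le_imp_power_dvd)
  next
    case infinity
    then obtain z where "y p = Inr z" "z \<in> carrier (Zp p)"
      using yp[OF p] by (auto simp: local_factor_def image_group_carrier)
    then show ?thesis
      using ij p by (simp add: a_def Zp_carrier_iff prime_gt_0_nat le_imp_power_dvd)
  qed
  obtain f where f: "f \<in> carrier Zhat" "\<And>p k. prime p \<Longrightarrow> f (p ^ k) = a p k"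
    using Zhat_from_prime_powers[of a] coherent by blast
  have "Zhat_local w f p = y p" for p
  proof (cases "prime p")
    case p: True
    show ?thesis
    proof (cases "phi w p")
      case (enat k)
      then obtain c where "y p = Inl c" "0 \<le> c" "c < int (p ^ k)"
        using yp[OF p] p
        by (auto simp: local_factor_def image_group_carrier carrier_integer_mod_group)
      \<comment> \<open>Since \<open>c\<close> lies between \<open>0\<close> and
        \<open>p ^ k\<close>, its residue modulo \<open>p ^ k\<close> is \<open>c\<close>
        itself.\<close>
      then show ?thesis using p enat f(2)[OF p] by (simp add: Zhat_local_def a_def)
    next
      case infinity
      then obtain z where z: "y p = Inr z" "z \<in> carrier (Zp p)"
        using yp[OF p] by (auto simp: local_factor_def image_group_carrier)
      have "restrict f (range (\<lambda>k. p ^ k)) = z"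
        using z p f(2)[OF p]
        by (intro extensionalityI[of _ "range (\<lambda>k. p ^ k)"])
          (auto simp: a_def Zp_carrier_iff prime_gt_0_nat)
      then show ?thesis using p infinity z(1) by (simp add: Zhat_local_def)
    qed
  next
    case False
    then show ?thesis using y by (auto simp: Zhat_local_def)
  qed
  then have "y = Zhat_local w f" by auto
  then show "y \<in> Zhat_local w ` carrier Zhat" using f(1) by blast
qed

section \<open>Assembly of the isomorphisms\<close>

theorem corollary6p2:
  fixes w :: "int filter"
  assumes "ultrafilter w" and "w \<noteq> principal {0}"
  shows "(\<exists>H N. subgroup H (ultraproduct_Zmod w) \<and>
            quotient_monoid betaZ (strong_cong w) \<cong> (ultraproduct_Zmod w)\<lparr>carrier := H\<rparr> \<and>
            N \<lhd> Zhat \<and>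
            (ultraproduct_Zmod w)\<lparr>carrier := H\<rparr> \<cong> Zhat Mod N) \<and>
         (self_divisible w \<longrightarrow>
            quotient_monoid betaZ (strong_cong w)
              \<cong> product_group {p. prime p} (local_factor w))"
proof (intro conjI impI)
  note nz = nonzero_mem_ultrafilter[OF assms]
  let ?U = "ultraproduct_Zmod w" and ?h = "Zhat_to_ultraproduct w"
  \<comment> \<open>The subgroup is the whole image of \<open>Zhat\<close>; as
    \<open>uf_residue\<close> is onto, it is also the image of \<open>betaZ\<close>.\<close>
  define H where "H = ?h ` carrier Zhat"
  interpret U: group ?U by (rule group_ultraproduct_Zmod[OF assms])
  interpret h: group_hom Zhat ?U ?h
    by (intro group_hom.intro group_hom_axioms.intro group_Zhat U.is_group Zhat_to_ultraproduct_hom nz)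
  have H: "subgroup H ?U" unfolding H_def by (rule h.img_is_subgroup)
  \<comment> \<open>Cutting the codomain down to \<open>H\<close> makes the map surjective, as both
    isomorphism theorems below require.\<close>
  have hH: "?h \<in> hom Zhat (?U\<lparr>carrier := H\<rparr>)"
    using Zhat_to_ultraproduct_hom[OF nz] by (auto simp: hom_def H_def)
  interpret hH: group_hom Zhat "?U\<lparr>carrier := H\<rparr>" ?h
    by (intro group_hom.intro group_hom_axioms.intro group_Zhat U.subgroup_imp_group[OF H] hH)
  let ?N = "kernel Zhat (?U\<lparr>carrier := H\<rparr>) ?h"
  have "Zhat Mod ?N \<cong> ?U\<lparr>carrier := H\<rparr>"
    by (rule hH.FactGroup_iso) (simp add: H_def)
  then have "?U\<lparr>carrier := H\<rparr> \<cong> Zhat Mod ?N"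
    by (rule group.iso_sym[OF normal.factorgroup_is_group[OF hH.normal_kernel]])
  moreover have "quotient_monoid betaZ (strong_cong w) \<cong> ?U\<lparr>carrier := H\<rparr>"
    by (rule quotient_betaZ_iso[OF nz hH]) (simp_all add: H_def Zhat_to_ultraproduct_eq_iff[OF nz])
  ultimately show "\<exists>H N. subgroup H ?U \<and>
      quotient_monoid betaZ (strong_cong w) \<cong> ?U\<lparr>carrier := H\<rparr> \<and>
      N \<lhd> Zhat \<and> ?U\<lparr>carrier := H\<rparr> \<cong> Zhat Mod N"
    using H hH.normal_kernel by blast
  assume "self_divisible w"
  \<comment> \<open>Equality under \<open>Zhat_local w\<close> and \<open>Zhat_agree w\<close> are
    both equality at the prime powers \<open>p ^ k\<close> with
    \<open>k \<le> phi w p\<close>.\<close>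
  then show "quotient_monoid betaZ (strong_cong w) \<cong> product_group {p. prime p} (local_factor w)"
    by (intro quotient_betaZ_iso[OF nz Zhat_local_hom Zhat_local_surj])
      (simp add: Zhat_local_eq_iff Zhat_agree_iff_prime_powers[OF assms(1) nz])
qed

end
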